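(* Let $X\subseteq\mathbb{R}^n$ be a nonempty open set, $C\subseteq\mathbb{R}^m$ a closed pointed convex cone with nonempty interior, $f:X\to\mathbb{R}^m$ locally Lipschitz, $\eta:X\times X\to\mathbb{R}^n$ a mapping, and $e\in\mathbb{R}^m$ with $e>_C 0$. Let $\xi\in X$ and suppose that $f$ is approximate $(\eta,e)$-invex at $\xi$. If $\xi$ is a solution of (SVVI), then $\xi$ is a local $(\eta,e)$-quasi efficient solution of the vector optimization problem (VOP) $\min_{x\in X} f(x)$.
   Context: Ordering: for $u,v\in\mathbb{R}^m$, $u\ge_C v$ (equivalently $v\le_C u$) means $u-v\in C$, and $u>_C v$ (equivalently $v<_C u$) means $u-v\in\operatorname{int} C$. $B(x_0,r)$ is the open ball of center $x_0$ and radius $r$; only points of $X$ are considered, since $f$ and $\eta$ are defined on $X$ and $X\times X$. Clarke's generalized Jacobian of $f$ at $x\in X$ is the set of $m\times n$ matrices $\partial f(x)=\operatorname{co}\{\lim_{i\to\infty} Jf(x^{(i)}) : x^{(i)}\to x,\ x^{(i)}\in S\}$, where $\operatorname{co}$ is the convex hull, $S$ is the set of points at which $f$ is differentiable, and $Jf$ is the Jacobian matrix (the limits being those that exist). Approximate $(\eta,e)$-invexity: $f$ is approximate $(\eta,e)$-invex at $x_0\in X$ if there is $r>0$ such that for all $x,y\in B(x_0,r)$, $f(x)-f(y)\ge_C A_y\,\eta(x,y)-e\,\|\eta(x,y)\|$ for all $A_y\in\partial f(y)$. (SVVI): $\xi\in X$ is a solution of (SVVI) if there is no $x\in X\setminus\{\xi\}$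 such that $A_\xi\,\eta(x,\xi)\le_C 0$ for all $A_\xi\in\partial f(\xi)$. Local $(\eta,e)$-quasi efficient solution: $\xi\in X$ is such a solution of (VOP) if there is $r>0$ such that there is no $x\in B(\xi,r)\setminus\{\xi\}$ satisfying $f(x)+e\,\|\eta(x,\xi)\|\le_C f(\xi)$. *)

theory Defs
  imports "HOL-Analysis.Analysis"
begin

definition cone_le :: "(real^'m) set \<Rightarrow> real^'m \<Rightarrow> real^'m \<Rightarrow> bool" where
  "cone_le C u v \<longleftrightarrow> v - u \<in> C"

definition cone_less :: "(real^'m) set \<Rightarrow> real^'m \<Rightarrow> real^'m \<Rightarrow> bool" where
  "cone_less C u v \<longleftrightarrow> v - u \<in> interior C"

text \<open>The library's \<^const>\<open>convex_cone\<close> is nonempty and closed under scaling by \<open>c \<ge> 0\<close>, so it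
  contains the origin; for closed nonempty cones this agrees with the convention \<open>c > 0\<close>.\<close>
definition pointed_convex_cone :: "(real^'m) set \<Rightarrow> bool" where
  "pointed_convex_cone C \<longleftrightarrow> convex_cone C \<and> C \<inter> uminus ` C = {0}"

definition locally_lipschitz_on :: "(real^'n) set \<Rightarrow> (real^'n \<Rightarrow> real^'m) \<Rightarrow> bool" where
  "locally_lipschitz_on X f \<longleftrightarrow>
     (\<forall>x\<in>X. \<exists>u>0. \<exists>L. L-lipschitz_on (ball x u \<inter> X) f)"

text \<open>In the following, \<open>f\<close> and \<open>\<eta>\<close> are total functions of which only the values on \<open>X\<close> and on
  \<open>X \<times> X\<close> matter. Differentiability with \<open>at x\<close> depends only on \<open>f\<close> on \<open>X\<close> when \<open>x \<in> X\<close> and \<open>X\<close>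
  is open.\<close>

definition differentiability_points ::
  "(real^'n) set \<Rightarrow> (real^'n \<Rightarrow> real^'m) \<Rightarrow> (real^'n) set" where
  "differentiability_points X f = {x \<in> X. f differentiable (at x)}"

definition clarke_jacobian ::
  "(real^'n) set \<Rightarrow> (real^'n \<Rightarrow> real^'m) \<Rightarrow> real^'n \<Rightarrow> (real^'n^'m) set" where
  "clarke_jacobian X f x = convex hull
     {A. \<exists>s :: nat \<Rightarrow> real^'n. (\<forall>i. s i \<in> differentiability_points X f) \<and> s \<longlonglongrightarrow> x \<and>
           (\<lambda>i. jacobian f (at (s i))) \<longlonglongrightarrow> A}"

definition approximate_invex ::
  "(real^'n) set \<Rightarrow> (real^'m) set \<Rightarrow> (real^'n \<Rightarrow> real^'n \<Rightarrow> real^'n) \<Rightarrow> real^'m \<Rightarrow>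
   (real^'n \<Rightarrow> real^'m) \<Rightarrow> real^'n \<Rightarrow> bool" where
  "approximate_invex X C \<eta> e f x\<^sub>0 \<longleftrightarrow>
     (\<exists>r>0. \<forall>x \<in> ball x\<^sub>0 r \<inter> X. \<forall>y \<in> ball x\<^sub>0 r \<inter> X. \<forall>A \<in> clarke_jacobian X f y.
        cone_le C (A *v \<eta> x y - norm (\<eta> x y) *\<^sub>R e) (f x - f y))"

definition svvi_solution ::
  "(real^'n) set \<Rightarrow> (real^'m) set \<Rightarrow> (real^'n \<Rightarrow> real^'n \<Rightarrow> real^'n) \<Rightarrow>
   (real^'n \<Rightarrow> real^'m) \<Rightarrow> real^'n \<Rightarrow> bool" where
  "svvi_solution X C \<eta> f \<xi> \<longleftrightarrow> \<xi> \<in> X \<and>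
     \<not> (\<exists>x \<in> X - {\<xi>}. \<forall>A \<in> clarke_jacobian X f \<xi>. cone_le C (A *v \<eta> x \<xi>) 0)"

definition local_quasi_efficient ::
  "(real^'n) set \<Rightarrow> (real^'m) set \<Rightarrow> (real^'n \<Rightarrow> real^'n \<Rightarrow> real^'n) \<Rightarrow> real^'m \<Rightarrow>
   (real^'n \<Rightarrow> real^'m) \<Rightarrow> real^'n \<Rightarrow> bool" where
  "local_quasi_efficient X C \<eta> e f \<xi> \<longleftrightarrow> \<xi> \<in> X \<and>
     (\<exists>r>0. \<not> (\<exists>x \<in> (ball \<xi> r \<inter> X) - {\<xi>}. cone_le C (f x + norm (\<eta> x \<xi>) *\<^sub>R e) (f \<xi>)))"

end

theory Submission
  imports Defs
begin

text \<open>The radius of approximate invexity at \<open>\<xi>\<close> also serves for quasi efficiency. A point \<open>x\<close> of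
  that ball violating quasi efficiency gives \<open>f \<xi> - f x - \<parallel>\<eta> x \<xi>\<parallel> e \<in> C\<close>, while invexity with
  \<open>y = \<xi>\<close> gives \<open>f x - f \<xi> - A (\<eta> x \<xi>) + \<parallel>\<eta> x \<xi>\<parallel> e \<in> C\<close> for each generalized Jacobian \<open>A\<close> at
  \<open>\<xi>\<close>. In the sum of the two, which lies in the convex cone \<open>C\<close>, the values of \<open>f\<close> and the error
  terms cancel. What is left is \<open>- A (\<eta> x \<xi>) \<in> C\<close> for every \<open>A\<close>, and this is what a solution
  of the variational inequality excludes.\<close>

theorem theorem3p1:
  fixes X :: "(real^'n) set"
    and C :: "(real^'m) set"
    and f :: "real^'n \<Rightarrow> real^'m"
    and \<eta> :: "real^'n \<Rightarrow> real^'n \<Rightarrow> real^'n"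
    and e :: "real^'m"
    and \<xi> :: "real^'n"
  assumes "X \<noteq> {}" and "open X"
    and "closed C" and "pointed_convex_cone C" and "interior C \<noteq> {}"
    and "locally_lipschitz_on X f"
    and "cone_less C 0 e"
    and "\<xi> \<in> X"
    and "approximate_invex X C \<eta> e f \<xi>"
    and "svvi_solution X C \<eta> f \<xi>"
  shows "local_quasi_efficient X C \<eta> e f \<xi>"
proof -
  from assms(4) have cone: "convex_cone C"
    by (simp add: pointed_convex_cone_def)
  from assms(9) obtain r where "r > 0"
    and invex: "\<And>x y A. x \<in> ball \<xi> r \<inter> X \<Longrightarrow> y \<in> ball \<xi> r \<inter> X \<Longrightarrow> A \<in> clarke_jacobian X f y \<Longrightarrow>
        cone_le C (A *v \<eta> x y - norm (\<eta> x y) *\<^sub>R e) (f x - f y)"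
    unfolding approximate_invex_def by blast
  have "\<not> cone_le C (f x + norm (\<eta> x \<xi>) *\<^sub>R e) (f \<xi>)" if x: "x \<in> (ball \<xi> r \<inter> X) - {\<xi>}" for x
  proof
    assume better: "cone_le C (f x + norm (\<eta> x \<xi>) *\<^sub>R e) (f \<xi>)"
    have "cone_le C (A *v \<eta> x \<xi>) 0" if A: "A \<in> clarke_jacobian X f \<xi>" for A
    proof -
      have "cone_le C (A *v \<eta> x \<xi> - norm (\<eta> x \<xi>) *\<^sub>R e) (f x - f \<xi>)"
        using invex x A \<open>r > 0\<close> \<open>\<xi> \<in> X\<close> by simp
      with better have "(f \<xi> - (f x + norm (\<eta> x \<xi>) *\<^sub>R e)) +
          ((f x - f \<xi>) - (A *v \<eta> x \<xi> - norm (\<eta> x \<xi>) *\<^sub>R e)) \<in> C"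
        unfolding cone_le_def by (rule convex_cone_add[OF cone])
      then show ?thesis
        by (simp add: cone_le_def)
    qed
    with x assms(10) show False
      unfolding svvi_solution_def by blast
  qed
  with \<open>r > 0\<close> \<open>\<xi> \<in> X\<close> show ?thesis
    unfolding local_quasi_efficient_def by blast
qed

end
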